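(* There holds $$\Xi_N=2\cos(\Omega)+2\Theta_N\sin(\Omega)+\mathcal{O}(|\mathcal{E}_N|^2),$$ where $\Theta_N\in\mathbb{R}$ is given by $$\Theta_N=\mathrm{Im}(\mathcal{E}_N)+\mathrm{Re}(\mathcal{E}_N)\,\frac{\mathrm{Im}\big((F_N^-)^2\mathrm{e}^{i\Omega}\big)}{\mathrm{Re}\big((F_N^-)^2\mathrm{e}^{i\Omega}\big)},$$ and $$\mathcal{E}_N=\frac{\mathrm{e}^{i\Omega}-[N+1/N]_{\mathrm{e}^{i\Omega}}}{\mathrm{e}^{i\Omega}},$$ with $[N+1/N]_{\mathrm{e}^{i\Omega}}=F_{N+1}^+/F_N^-$ being the $[N+1/N]$-Padé approximant of $\mathrm{e}^{i\Omega}$. Moreover, there holds $$\rho_N^\pm=\pm i\,\Theta_N+\mathcal{O}(|\mathcal{E}_N|^2).$$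
   Context: $N\ge0$ is an integer (polynomial degree) and $\Omega=\omega h\in\mathbb{R}$ is the product of the temporal frequency $\omega$ and the mesh size $h$. ${}_1F_1(a,b,z)=\sum_{m\ge0}\frac{(a)_m}{(b)_m}\frac{z^m}{m!}$ is the confluent hypergeometric function, with $(a)_0=1$, $(a)_m=a(a+1)\cdots(a+m-1)$; when $a$ is a non-positive integer the series terminates at $m=-a$. Set $$F_N^\pm={}_1F_1(-N,-2N-1,\pm i\Omega),\qquad F_{N+1}^\pm={}_1F_1(-N-1,-2N-1,\pm i\Omega)$$ (note that $F_{N+1}^\pm$ also has second parameter $-2N-1$), and $$\Xi_N=\frac{(F_N^-)^2+(F_N^+)^2+(F_{N+1}^-)^2+(F_{N+1}^+)^2}{F_N^-F_{N+1}^++F_N^+F_{N+1}^-},$$ which is real. The numbers $\lambda_N^\pm$ are the two roots of $\lambda^2-\Xi_N\lambda+1=0$, labelled by $$\lambda_N^\pm=\frac{\Xi_N\pm\sqrt{\Xi_N^2-4}}{2}\ \text{ if }\sin(\Omega)\ge0,\qquad \lambda_N^\pm=\frac{\Xi_N\mp\sqrt{\Xi_N^2-4}}{2}\ \text{ if }\sin(\Omega)<0$$ (with $\sqrt{x}=i\sqrt{|x|}$ for $x<0$); they are the discrete Floquet multipliers of an energy-conserving discontinuous Galerkin method for the one-way wave equation, and approximate $\mathrm{e}^{\pm i\Omega}$. The relative errors are $$\rho_N^\pm=\frac{\mathrm{e}^{\pm i\Omega}-\lambda_N^\pm}{\mathrm{e}^{\pm i\Omega}}.$$ The $\mathcal{O}(|\mathcal{E}_N|^2)$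 terms refer to series expansion in $\mathcal{E}_N\ll1$.
   Formalization: The O(|E_N|²) claim for ρ_N^± fails near sin Ω=0 (N=0, Ω→0: the difference is ~iΩ³/8, |E|²~Ω⁴/4), so it is stated on compact sets of Ω with sin Ω≠0, with O(|E_N|²/|sin Ω|) for |E_N|≤δ|sin Ω| up to the zeros; the O-terms are uniform in N and on compact sets of Ω. *)

theory Defs
  imports
    "HOL-Analysis.Analysis"
    "HOL-Computational_Algebra.Polynomial_FPS"
begin

text \<open>
  Confluent hypergeometric series. For \<open>a = - of_nat n\<close> all terms with \<open>m > n\<close> vanish because
  \<open>pochhammer a m = 0\<close>; this includes those where \<open>b\<close> is also a negative integer and
  \<open>pochhammer b m = 0\<close>, since \<open>0 / 0 = 0\<close>. So the series terminates at \<open>m = n\<close>, as required.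
\<close>

definition hyp1F1 :: "complex \<Rightarrow> complex \<Rightarrow> complex \<Rightarrow> complex" where
  "hyp1F1 a b z = (\<Sum>m. pochhammer a m / pochhammer b m * (z ^ m / fact m))"

lemma hyp1F1_terminating:
  "hyp1F1 (- of_nat n) b z =
     (\<Sum>m\<le>n. pochhammer (- of_nat n) m / pochhammer b m * (z ^ m / fact m))"
  unfolding hyp1F1_def
  by (rule suminf_finite) (auto simp: pochhammer_of_nat_eq_0_iff)

text \<open>
  In everything below, a superscript \<open>\<plusminus>\<close> is rendered by a sign argument \<open>\<sigma>\<close> that is only meant
  to take the values \<open>1\<close> and \<open>-1\<close>. \<open>F\<close> and \<open>G\<close> are the \<open>F\<^sub>N\<close> and \<open>F\<^sub>N\<^sub>+\<^sub>1\<close> of the paper; both have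
  second parameter \<open>-2N-1\<close>, so \<open>G \<sigma> N\<close> is not \<open>F \<sigma> (N + 1)\<close>.
\<close>

definition F :: "real \<Rightarrow> nat \<Rightarrow> real \<Rightarrow> complex" where
  "F \<sigma> N \<Omega> = hyp1F1 (- of_nat N) (- of_nat (2 * N + 1)) (of_real \<sigma> * \<i> * of_real \<Omega>)"

definition G :: "real \<Rightarrow> nat \<Rightarrow> real \<Rightarrow> complex" where
  "G \<sigma> N \<Omega> = hyp1F1 (- of_nat (N + 1)) (- of_nat (2 * N + 1)) (of_real \<sigma> * \<i> * of_real \<Omega>)"

definition Xi :: "nat \<Rightarrow> real \<Rightarrow> complex" where
  "Xi N \<Omega> =
     ((F (-1) N \<Omega>)\<^sup>2 + (F 1 N \<Omega>)\<^sup>2 + (G (-1) N \<Omega>)\<^sup>2 + (G 1 N \<Omega>)\<^sup>2)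
     / (F (-1) N \<Omega> * G 1 N \<Omega> + F 1 N \<Omega> * G (-1) N \<Omega>)"

lemma cnj_F: "cnj (F \<sigma> N \<Omega>) = F (-\<sigma>) N \<Omega>"
  and cnj_G: "cnj (G \<sigma> N \<Omega>) = G (-\<sigma>) N \<Omega>"
proof -
  have poch: "cnj (pochhammer a m) = pochhammer (cnj a) m" for a m
    by (simp add: pochhammer_prod)
  have "cnj (hyp1F1 (- of_nat n) (- of_nat k) z) = hyp1F1 (- of_nat n) (- of_nat k) (cnj z)"
    for n k z
    by (simp add: hyp1F1_terminating poch)
  note * = this
  show "cnj (F \<sigma> N \<Omega>) = F (-\<sigma>) N \<Omega>" "cnj (G \<sigma> N \<Omega>) = G (-\<sigma>) N \<Omega>"
    unfolding F_def G_def * by simp_all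
qed

lemma Xi_real: "Xi N \<Omega> \<in> \<real>"
  unfolding Reals_cnj_iff by (simp add: Xi_def cnj_F cnj_G add_ac mult_ac)

text \<open>
  \<open>Xi N \<Omega>\<close> is real, and for real \<open>x\<close> the principal branch \<open>csqrt\<close> is \<open>sqrt x\<close> if \<open>x \<ge> 0\<close> and
  \<open>\<i> * sqrt \<bar>x\<bar>\<close> if \<open>x < 0\<close>.
\<close>

definition lam :: "real \<Rightarrow> nat \<Rightarrow> real \<Rightarrow> complex" where
  "lam \<sigma> N \<Omega> =
     (if sin \<Omega> \<ge> 0
      then (Xi N \<Omega> + of_real \<sigma> * csqrt ((Xi N \<Omega>)\<^sup>2 - 4)) / 2
      else (Xi N \<Omega> - of_real \<sigma> * csqrt ((Xi N \<Omega>)\<^sup>2 - 4)) / 2)"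

lemma lam_root:
  assumes "\<sigma> \<in> {1, -1}"
  shows "(lam \<sigma> N \<Omega>)\<^sup>2 - Xi N \<Omega> * lam \<sigma> N \<Omega> + 1 = 0"
proof -
  have "((x + s) / 2)\<^sup>2 - x * ((x + s) / 2) + 1 = 0" if "s\<^sup>2 = x\<^sup>2 - 4" for x s :: complex
  proof -
    have "((x + s) / 2)\<^sup>2 - x * ((x + s) / 2) + 1 = (s\<^sup>2 - (x\<^sup>2 - 4)) / 4"
      by (simp add: field_simps power2_eq_square)
    with that show ?thesis by simp
  qed
  from this[of "csqrt ((Xi N \<Omega>)\<^sup>2 - 4)"] this[of "- csqrt ((Xi N \<Omega>)\<^sup>2 - 4)"] assms
  show ?thesis by (auto simp: lam_def)
qed

definition rho :: "real \<Rightarrow> nat \<Rightarrow> real \<Rightarrow> complex" where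
  "rho \<sigma> N \<Omega> = (cis (\<sigma> * \<Omega>) - lam \<sigma> N \<Omega>) / cis (\<sigma> * \<Omega>)"

text \<open>
  \<open>P / Q\<close>, with the usual normalisation \<open>Q(0) = 1\<close>, is the \<open>[m/n]\<close> Pade approximant of the
  power series \<open>f\<close>: \<open>f - P / Q = O(z\<^bsup>m+n+1\<^esup>)\<close>.
\<close>

definition pade_approximant ::
    "nat \<Rightarrow> nat \<Rightarrow> complex fps \<Rightarrow> complex poly \<Rightarrow> complex poly \<Rightarrow> bool" where
  "pade_approximant m n f P Q \<longleftrightarrow>
     degree P \<le> m \<and> degree Q \<le> n \<and> poly Q 0 = 1 \<and>
     (\<forall>k\<le>m + n. fps_nth (f - fps_of_poly P / fps_of_poly Q) k = 0)"

definition Err :: "nat \<Rightarrow> real \<Rightarrow> complex" where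
  "Err N \<Omega> = (cis \<Omega> - G 1 N \<Omega> / F (-1) N \<Omega>) / cis \<Omega>"

definition Theta :: "nat \<Rightarrow> real \<Rightarrow> real" where
  "Theta N \<Omega> =
     Im (Err N \<Omega>) + Re (Err N \<Omega>) * (Im ((F (-1) N \<Omega>)\<^sup>2 * cis \<Omega>) / Re ((F (-1) N \<Omega>)\<^sup>2 * cis \<Omega>))"

text \<open>
  The remainder \<open>R\<close> is \<open>O(|\<E>\<^sub>N|\<^sup>2)\<close> as \<open>\<E>\<^sub>N \<rightarrow> 0\<close>, for \<open>\<Omega>\<close> ranging over \<open>K\<close>. The constants do not
  depend on \<open>N\<close> or on \<open>\<Omega> \<in> K\<close>, so this covers \<open>N \<rightarrow> \<infinity>\<close> with \<open>\<Omega>\<close> fixed, and also \<open>\<Omega> \<rightarrow> 0\<close> with \<open>N\<close>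
  fixed if \<open>K\<close> is a neighbourhood of \<open>0\<close>.
\<close>

definition O_Err_squared_on :: "real set \<Rightarrow> (nat \<Rightarrow> real \<Rightarrow> complex) \<Rightarrow> bool" where
  "O_Err_squared_on K R \<longleftrightarrow>
     (\<exists>C. \<exists>\<delta>>0. \<forall>N. \<forall>\<Omega>\<in>K. cmod (Err N \<Omega>) \<le> \<delta> \<longrightarrow> cmod (R N \<Omega>) \<le> C * (cmod (Err N \<Omega>))\<^sup>2)"

end

theory Submission
  imports Defs "HOL-Real_Asymp.Real_Asymp"
begin

text \<open>
  Write \<open>f = F\<^sub>N\<^sup>-\<close>, \<open>w = f\<^sup>2 e\<^bsup>i\<Omega>\<^esup>\<close> and \<open>E = \<E>\<^sub>N\<close>, so that \<open>F\<^bsub>N+1\<^esub>\<^sup>+ = e\<^bsup>i\<Omega>\<^esup> f (1 - E)\<close>. Then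
  \<open>\<Xi>\<^sub>N = Re (e\<^bsup>-i\<Omega>\<^esup> w + e\<^bsup>i\<Omega>\<^esup> w (1 - E)\<^sup>2) / Re (w (1 - E))\<close> and \<open>\<Theta>\<^sub>N = Im (w E) / Re w\<close>, and the
  expansion of \<open>\<Xi>\<^sub>N\<close> follows, with absolute constants, as soon as \<open>w\<close> stays away from the imaginary
  axis. The expansion of \<open>\<lambda>\<^sub>N\<^sup>\<plusminus>\<close> then comes from linearising the square root; it loses a factor
  \<open>|sin \<Omega>|\<close> because the two roots nearly coincide when \<open>sin \<Omega>\<close> is small. The Pade property of
  \<open>F\<^bsub>N+1\<^esub>\<^sup>+ / F\<^sub>N\<^sup>-\<close> is an instance of Vandermonde's convolution.
\<close>

section \<open>Hypergeometric polynomials and the Pade property of their quotient\<close>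

definition hyp_poly :: "nat \<Rightarrow> nat \<Rightarrow> complex poly" where
  "hyp_poly n k =
     (\<Sum>m\<le>n. monom (pochhammer (- of_nat n) m / pochhammer (- of_nat k) m / fact m) m)"

lemma poly_hyp_poly: "poly (hyp_poly n k) z = hyp1F1 (- of_nat n) (- of_nat k) z"
  by (simp add: hyp_poly_def hyp1F1_terminating poly_sum poly_monom)

lemma coeff_hyp_poly:
  "coeff (hyp_poly n k) m = pochhammer (- of_nat n) m / pochhammer (- of_nat k) m / fact m"
  by (auto simp: hyp_poly_def coeff_sum pochhammer_of_nat_eq_0_iff)

lemma degree_hyp_poly: "degree (hyp_poly n k) \<le> n"
  by (rule degree_le) (simp add: coeff_hyp_poly pochhammer_of_nat_eq_0_iff)

lemma pochhammer_minus_of_nat: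
  "pochhammer (- of_nat n :: complex) m = (- 1) ^ m * fact m * of_nat (n choose m)"
  unfolding binomial_gbinomial gbinomial_pochhammer
  by (simp add: power_mult_distrib[symmetric])

text \<open>The signs of the two Pochhammer symbols cancel. The common denominator
  \<open>fact k\<close> prepares the coefficients for a binomial convolution.\<close>

lemma coeff_hyp_poly_binomial:
  assumes "m \<le> k"
  shows "coeff (hyp_poly n k) m = of_nat (n choose m) * (fact (k - m) / fact k)"
proof -
  have "(of_nat (k choose m) :: complex) = fact k / (fact m * fact (k - m))"
    using assms by (rule binomial_fact)
  then show ?thesis
    by (simp add: coeff_hyp_poly pochhammer_minus_of_nat)
qed

text \<open>Negating the upper index turns the second binomial, up to sign, into
  \<open>(k - 2n - 2) gchoose (k - j)\<close>. Its upper index is free of \<open>j\<close>, so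
  Vandermonde applies; the resulting \<open>(k - n - 2) gchoose k\<close> is negated back.\<close>

lemma alternating_binomial_convolution:
  assumes "k \<le> 2 * n + 1"
  shows "(\<Sum>j\<le>k. (- 1) ^ j * of_nat (n choose j) * of_nat ((2 * n + 1 - j) choose (k - j)))
         = (of_nat ((n + 1) choose k) :: complex)"
proof -
  have upper: "of_nat ((2 * n + 1 - j) choose (k - j))
      = (- 1) ^ (k - j) * ((of_nat k - of_nat (2 * n + 2) :: complex) gchoose (k - j))"
    if "j \<le> k" for j
    unfolding binomial_gbinomial
    by (subst gbinomial_negated_upper) (use that assms in \<open>simp add: of_nat_diff algebra_simps\<close>)
  have "(\<Sum>j\<le>k. (- 1) ^ j * of_nat (n choose j) * of_nat ((2 * n + 1 - j) choose (k - j)))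
     = (\<Sum>j\<le>k. (- 1) ^ k * ((of_nat n gchoose j)
          * ((of_nat k - of_nat (2 * n + 2) :: complex) gchoose (k - j))))"
  proof (rule sum.cong[OF refl])
    fix j assume "j \<in> {..k}"
    then have j: "j \<le> k" by simp
    then have sign: "(- 1) ^ k = (- 1 :: complex) ^ j * (- 1) ^ (k - j)"
      by (simp flip: power_add)
    show "(- 1) ^ j * of_nat (n choose j) * of_nat ((2 * n + 1 - j) choose (k - j))
      = (- 1) ^ k * ((of_nat n gchoose j)
          * ((of_nat k - of_nat (2 * n + 2) :: complex) gchoose (k - j)))"
      unfolding upper[OF j] sign by (simp add: binomial_gbinomial)
  qed
  also have "\<dots> = (- 1) ^ k * ((of_nat n + (of_nat k - of_nat (2 * n + 2)) :: complex) gchoose k)"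
    by (simp only: sum_distrib_left[symmetric] atMost_atLeast0 gbinomial_Vandermonde)
  also have "\<dots> = of_nat ((n + 1) choose k)"
    unfolding binomial_gbinomial
    by (subst gbinomial_negated_upper[of "of_nat (n + 1)"]) (simp add: algebra_simps)
  finally show ?thesis .
qed

definition pade_num :: "nat \<Rightarrow> complex poly" where
  "pade_num n = hyp_poly (n + 1) (2 * n + 1)"

text \<open>Substituting \<open>-z\<close> makes the value at \<open>\<i> * \<Omega>\<close> equal
  to \<open>F (-1)\<close>, whose argument is \<open>- \<i> * \<Omega>\<close>.\<close>

definition pade_den :: "nat \<Rightarrow> complex poly" where
  "pade_den n = pcompose (hyp_poly n (2 * n + 1)) (monom (- 1) 1)"

lemma F_eq_pade_den: "F \<sigma> n \<Omega> = poly (pade_den n) (- of_real \<sigma> * (\<i> * of_real \<Omega>))"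
  by (simp add: F_def pade_den_def poly_pcompose poly_monom poly_hyp_poly mult_ac)

lemma G_eq_pade_num: "G \<sigma> n \<Omega> = poly (pade_num n) (of_real \<sigma> * (\<i> * of_real \<Omega>))"
  by (simp add: G_def pade_num_def poly_hyp_poly mult_ac)

lemma degree_pade_num: "degree (pade_num n) \<le> n + 1"
  unfolding pade_num_def by (rule degree_hyp_poly)

lemma degree_pade_den: "degree (pade_den n) \<le> n"
  unfolding pade_den_def
  by (rule degree_le) (simp add: coeff_hyp_poly pochhammer_of_nat_eq_0_iff)

lemma poly_pade_den_0: "poly (pade_den n) 0 = 1"
  by (simp add: pade_den_def poly_pcompose poly_monom poly_0_coeff_0 coeff_hyp_poly)

text \<open>Taking \<open>(2n+1-k)! / (2n+1)!\<close> out of the Cauchy product leaves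
  \<open>alternating_binomial_convolution\<close>. This quotient-free form of the Pade condition
  also feeds the reflection identity.\<close>

lemma exp_times_pade_den:
  assumes "k \<le> 2 * n + 1"
  shows "fps_nth (fps_exp 1 * fps_of_poly (pade_den n)) k = coeff (pade_num n) k"
proof -
  let ?M = "2 * n + 1"
  have "fps_nth (fps_exp 1 * fps_of_poly (pade_den n)) k
      = (\<Sum>j\<le>k. coeff (pade_den n) j / fact (k - j))"
    by (subst mult.commute) (simp add: fps_mult_nth atMost_atLeast0)
  also have "\<dots> = (\<Sum>j\<le>k. fact (?M - k) / fact ?M *
      ((- 1) ^ j * of_nat (n choose j) * of_nat ((?M - j) choose (k - j))))"
  proof (rule sum.cong[OF refl])
    fix j assume "j \<in> {..k}"
    then have j: "j \<le> k" by simp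
    then have *: "(of_nat ((?M - j) choose (k - j)) :: complex)
        = fact (?M - j) / (fact (k - j) * fact (?M - k))"
      using assms by (subst binomial_fact) auto
    show "coeff (pade_den n) j / fact (k - j) = fact (?M - k) / fact ?M *
      ((- 1) ^ j * of_nat (n choose j) * of_nat ((?M - j) choose (k - j)))"
      unfolding * pade_den_def using j assms
      by (simp add: coeff_hyp_poly_binomial divide_simps del: fact_Suc)
  qed
  also have "\<dots> = coeff (pade_num n) k"
    by (simp only: sum_distrib_left[symmetric] alternating_binomial_convolution[OF assms])
       (use assms in \<open>simp add: pade_num_def coeff_hyp_poly_binomial del: fact_Suc\<close>)
  finally show ?thesis .
qed

lemma fps_mult_nth_eq_0_left:
  fixes a b :: "'a :: semiring_0 fps"
  assumes "\<And>i. i \<le> k \<Longrightarrow> fps_nth a i = 0"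
  shows "fps_nth (a * b) k = 0"
  using assms by (simp add: fps_mult_nth)

lemma pade_approximant_exp: "pade_approximant (n + 1) n (fps_exp 1) (pade_num n) (pade_den n)"
  unfolding pade_approximant_def
proof (intro conjI allI impI degree_pade_num degree_pade_den poly_pade_den_0)
  fix k assume k: "k \<le> n + 1 + n"
  let ?P = "fps_of_poly (pade_num n)" and ?Q = "fps_of_poly (pade_den n)"
  have Q0: "fps_nth ?Q 0 \<noteq> 0"
    using poly_pade_den_0[of n] by (simp add: poly_0_coeff_0)
  \<comment> \<open>\<open>Q(0) = 1\<close> makes \<open>Q\<close> a unit, and multiplying by its
    inverse cannot lower the order of vanishing.\<close>
  then have "fps_exp 1 - ?P / ?Q = (fps_exp 1 * ?Q - ?P) * inverse ?Q"
    by (simp add: fps_divide_unit left_diff_distrib mult.assoc inverse_mult_eq_1')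
  then show "fps_nth (fps_exp 1 - ?P / ?Q) k = 0"
    using k by (simp only:) (rule fps_mult_nth_eq_0_left, simp add: exp_times_pade_den)
qed

section \<open>The modulus identity on the imaginary axis\<close>

text \<open>
  \<open>P(z)/Q(z)\<close> and \<open>P(-z)/Q(-z)\<close> approximate \<open>e\<^sup>z\<close> and \<open>e\<^bsup>-z\<^esup>\<close>, so \<open>P(z)P(-z)\<close> and \<open>Q(z)Q(-z)\<close> agree
  below order \<open>2n+2\<close>, which is their maximal degree.
\<close>

lemma pade_reflection_identity:
  "poly (pade_num n) z * poly (pade_num n) (- z)
    = poly (pade_den n) z * poly (pade_den n) (- z)
      + (- 1) ^ (n + 1) * (coeff (pade_num n) (n + 1))\<^sup>2 * z ^ (2 * n + 2)"
proof -
  let ?r = "\<lambda>p. pcompose p (monom (- 1 :: complex) 1)"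
  define p q where "p = pade_num n" and "q = pade_den n"
  define A where "A = fps_exp 1 * fps_of_poly q - fps_of_poly p"
  define B where "B = fps_exp (- 1) * fps_of_poly (?r q) - fps_of_poly (?r p)"
  have A: "fps_nth A i = 0" if "i \<le> 2 * n + 1" for i
    using exp_times_pade_den[OF that] by (simp add: A_def p_def q_def)
  have r: "fps_of_poly (?r s) = fps_of_poly s oo (- fps_X)" for s
    by (simp add: fps_eq_iff fps_compose_uminus')
  have "B = A oo (- fps_X)"
    by (simp add: A_def B_def r fps_compose_sub_distrib fps_compose_mult_distrib
        del: One_nat_def)
  then have B: "fps_nth B i = 0" if "i \<le> 2 * n + 1" for i
    using A[OF that] by (simp add: fps_compose_uminus')
  have exp: "fps_exp 1 * fps_exp (- 1) = (1 :: complex fps)"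
    by (simp flip: fps_exp_add_mult)
  \<comment> \<open>The mixed products \<open>e^z q(z) p(-z)\<close> cancel, and the last summand
    vanishes because \<open>e^z e^(-z) = 1\<close>. What remains carries a factor \<open>A\<close>
    or \<open>B\<close>.\<close>
  have "fps_of_poly (p * ?r p - q * ?r q)
      = - (B * (fps_exp 1 * fps_of_poly q) + A * fps_of_poly (?r p))
        + (fps_exp 1 * fps_exp (- 1) - 1) * (fps_of_poly q * fps_of_poly (?r q))"
    unfolding A_def B_def fps_of_poly_diff fps_of_poly_mult by (simp add: algebra_simps)
  then have eq: "fps_of_poly (p * ?r p - q * ?r q)
      = - (B * (fps_exp 1 * fps_of_poly q) + A * fps_of_poly (?r p))"
    by (simp add: exp)
  have low: "coeff (p * ?r p - q * ?r q) i = 0" if "i \<le> 2 * n + 1" for i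
  proof -
    have "fps_nth (fps_of_poly (p * ?r p - q * ?r q)) i = 0"
      unfolding eq using that A B by (simp add: fps_mult_nth_eq_0_left)
    then show ?thesis by simp
  qed
  have r_deg: "degree (?r s) \<le> degree s" for s
    by (rule order_trans[OF degree_pcompose_le]) (simp add: degree_monom_eq)
  have deg: "degree p \<le> n + 1" "degree (?r p) \<le> n + 1" "degree q \<le> n" "degree (?r q) \<le> n"
    using degree_pade_num[of n] degree_pade_den[of n] r_deg[of p] r_deg[of q]
    by (auto simp: p_def q_def)
  have dp: "degree (p * ?r p) \<le> 2 * n + 2" and dq: "degree (q * ?r q) \<le> 2 * n"
    using degree_mult_le[of p "?r p"] degree_mult_le[of q "?r q"] deg by linarith+
  have "coeff (p * ?r p) ((n + 1) + (n + 1)) = coeff p (n + 1) * coeff (?r p) (n + 1)"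
  \<comment> \<open>\<open>coeff_mult_degree_sum\<close> concerns exact degrees; if one factor falls
    short of \<open>n + 1\<close>, both sides are zero.\<close>
  proof (cases "degree p = n + 1 \<and> degree (?r p) = n + 1")
    case True
    then show ?thesis using coeff_mult_degree_sum[of p "?r p"] by simp
  next
    case False
    then have "degree (p * ?r p) < (n + 1) + (n + 1)"
      using degree_mult_le[of p "?r p"] deg by linarith
    moreover have "coeff p (n + 1) * coeff (?r p) (n + 1) = 0"
      using False deg by (metis coeff_eq_0 le_neq_implies_less mult_eq_0_iff)
    ultimately show ?thesis by (simp only: coeff_eq_0)
  qed
  moreover have r_top: "coeff (?r p) (n + 1) = (- 1) ^ (n + 1) * coeff p (n + 1)" by simp
  moreover have "(n + 1) + (n + 1) = 2 * n + 2" by simp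
  ultimately have top: "coeff (p * ?r p) (2 * n + 2) = (- 1) ^ (n + 1) * (coeff p (n + 1))\<^sup>2"
    by (simp only: r_top power2_eq_square mult_ac)
  have "p * ?r p - q * ?r q = monom ((- 1) ^ (n + 1) * (coeff p (n + 1))\<^sup>2) (2 * n + 2)"
  proof (rule poly_eqI)
    fix i
    consider "i \<le> 2 * n + 1" | "i = 2 * n + 2" | "i > 2 * n + 2" by linarith
    then show "coeff (p * ?r p - q * ?r q) i
        = coeff (monom ((- 1) ^ (n + 1) * (coeff p (n + 1))\<^sup>2) (2 * n + 2)) i"
    proof cases
      case 1
      then show ?thesis using low by simp
    next
      case 2
      then show ?thesis using top dq by (simp add: coeff_eq_0)
    next
      case 3
      then show ?thesis using dp dq by (simp add: coeff_eq_0)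
    qed
  qed
  then have "poly (p * ?r p - q * ?r q) z
      = (- 1) ^ (n + 1) * (coeff p (n + 1))\<^sup>2 * z ^ (2 * n + 2)"
    by (simp only: poly_monom)
  then show ?thesis
    by (simp add: p_def q_def poly_pcompose poly_monom algebra_simps)
qed

text \<open>Keeps the extra term in \<open>norm_G_F\<close> positive for
  \<open>\<Omega> \<noteq> 0\<close>, so that a small error can bound
  \<open>\<Omega>\<close>.\<close>

lemma coeff_pade_num_top: "coeff (pade_num n) (n + 1) \<noteq> 0"
  by (simp add: pade_num_def coeff_hyp_poly_binomial del: fact_Suc)

text \<open>For imaginary \<open>z\<close>, passing to \<open>-z\<close> is complex conjugation, so
  the reflection identity becomes one between squared moduli. Its sign cancels against
  \<open>\<i>^(2n+2)\<close>, and the leading coefficient is real.\<close>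

lemma norm_G_F:
  "(cmod (G 1 n \<Omega>))\<^sup>2 = (cmod (F (- 1) n \<Omega>))\<^sup>2
     + (cmod (coeff (pade_num n) (n + 1)))\<^sup>2 * \<Omega> ^ (2 * n + 2)"
proof -
  define c where "c = coeff (pade_num n) (n + 1)"
  have c: "c \<in> \<real>"
    by (simp add: c_def pade_num_def coeff_hyp_poly_binomial del: fact_Suc)
       (metis Reals_divide Reals_of_nat of_nat_fact)
  have "complex_of_real ((cmod (G 1 n \<Omega>))\<^sup>2) = G 1 n \<Omega> * G (- 1) n \<Omega>"
    by (simp only: complex_norm_square cnj_G)
  also have "\<dots> = F (- 1) n \<Omega> * F 1 n \<Omega>
      + (- 1) ^ (n + 1) * c\<^sup>2 * (\<i> * of_real \<Omega>) ^ (2 * n + 2)"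
    using pade_reflection_identity[of n "\<i> * of_real \<Omega>"]
    by (simp add: F_eq_pade_den G_eq_pade_num c_def)
  also have "F (- 1) n \<Omega> * F 1 n \<Omega> = complex_of_real ((cmod (F (- 1) n \<Omega>))\<^sup>2)"
    by (simp only: complex_norm_square cnj_F) simp
  also have "(\<i> * of_real \<Omega>) ^ (2 * n + 2) = (- 1) ^ (n + 1) * complex_of_real \<Omega> ^ (2 * n + 2)"
  proof -
    have "2 * n + 2 = 2 * (n + 1)" by simp
    then have "\<i> ^ (2 * n + 2) = (- 1) ^ (n + 1)" by (simp only: power_mult power2_i)
    then show ?thesis by (simp only: power_mult_distrib)
  qed
  also have "(- 1) ^ (n + 1) * c\<^sup>2 * ((- 1) ^ (n + 1) * complex_of_real \<Omega> ^ (2 * n + 2))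
     = complex_of_real ((cmod c)\<^sup>2 * \<Omega> ^ (2 * n + 2))"
  proof -
    have "(- 1) ^ (n + 1) * (- 1 :: complex) ^ (n + 1) = 1"
      by (simp flip: power_mult_distrib)
    moreover have "c\<^sup>2 = complex_of_real ((cmod c)\<^sup>2)"
      unfolding complex_norm_square using c by (simp add: power2_eq_square Reals_cnj_iff)
    ultimately show ?thesis by (simp add: mult_ac)
  qed
  finally show ?thesis
    unfolding c_def by (simp only: of_real_add[symmetric] of_real_eq_iff)
qed

section \<open>Uniform limit of \<open>F (- 1) n\<close> for growing degree\<close>

definition pade_ratio :: "nat \<Rightarrow> nat \<Rightarrow> complex" where
  "pade_ratio n m = pochhammer (- of_nat n) m / pochhammer (- of_nat (2 * n + 1)) m"

text \<open>The ratio is a quotient of binomials with the same lower index and a larger upper index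
  below. The bound supplies the majorant for Tannery's theorem.\<close>

lemma norm_pade_ratio_le_1: "cmod (pade_ratio n m) \<le> 1"
proof -
  have "pade_ratio n m = of_real (real (n choose m) / real ((2 * n + 1) choose m))"
    unfolding pade_ratio_def pochhammer_minus_of_nat by simp
  then have "cmod (pade_ratio n m) = real (n choose m) / real ((2 * n + 1) choose m)"
    by (simp only: norm_of_real) simp
  also have "\<dots> \<le> 1"
    using binomial_right_mono[of n "2 * n + 1" m] by (simp add: divide_le_eq_1) linarith
  finally show ?thesis .
qed

lemma pade_ratio_tendsto: "(\<lambda>n. pade_ratio n m) \<longlonglongrightarrow> (1 / 2) ^ m"
proof -
  have factor: "(\<lambda>n. (- of_nat n + of_nat i) / (- of_nat (2 * n + 1) + of_nat i) :: complex)
      \<longlonglongrightarrow> 1 / 2" for i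
  proof -
    have "(\<lambda>n. (- real n + real i) / (- real (2 * n + 1) + real i)) \<longlonglongrightarrow> 1 / 2"
      by real_asymp
    from tendsto_of_real[OF this, where ?'a = complex] show ?thesis by simp
  qed
  have "(\<lambda>n. \<Prod>i<m. (- of_nat n + of_nat i) / (- of_nat (2 * n + 1) + of_nat i) :: complex)
      \<longlonglongrightarrow> (\<Prod>i<m. 1 / 2)"
    by (intro tendsto_prod factor)
  then show ?thesis
    by (simp add: pade_ratio_def pochhammer_prod prod_dividef atLeast0LessThan)
qed

text \<open>The difference is a series whose \<open>m\<close>-th term is bounded by
  \<open>a m n\<close> for all \<open>\<Omega> \<in> K\<close> at once. Tannery's theorem passes to
  the limit in \<open>n\<close> under the sum of these bounds.\<close>

lemma F_uniform_limit:
  assumes "0 < e" and "\<And>\<Omega>. \<Omega> \<in> K \<Longrightarrow> \<bar>\<Omega>\<bar> \<le> M"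
  shows "\<forall>\<^sub>F n in sequentially. \<forall>\<Omega>\<in>K. cmod (F (- 1) n \<Omega> - cis (- (\<Omega> / 2))) < e"
proof -
  \<comment> \<open>The absolute value covers an empty \<open>K\<close>, for which \<open>M\<close>
    may be negative.\<close>
  define a where "a m n = cmod (pade_ratio n m - (1 / 2) ^ m) * (\<bar>M\<bar> ^ m / fact m)" for m n
  have lim: "(\<lambda>n. a m n) \<longlonglongrightarrow> 0" for m
  proof -
    have "(\<lambda>n. cmod (pade_ratio n m - (1 / 2) ^ m)) \<longlonglongrightarrow> 0"
      by (intro tendsto_norm_zero LIM_zero pade_ratio_tendsto)
    from tendsto_mult_right[OF this, of "\<bar>M\<bar> ^ m / fact m"] show ?thesis
      by (simp add: a_def)
  qed
  have bound: "norm (a m n) \<le> 2 * (\<bar>M\<bar> ^ m / fact m)" for m n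
  proof -
    have "cmod (pade_ratio n m - (1 / 2) ^ m) \<le> 1 + (1 / 2) ^ m"
      using norm_pade_ratio_le_1[of n m] norm_triangle_ineq4[of "pade_ratio n m" "(1 / 2) ^ m"]
      by (simp add: norm_power)
    also have "\<dots> \<le> 2"
      using power_le_one[of "1 / 2 :: real" m] by simp
    finally have "cmod (pade_ratio n m - (1 / 2) ^ m) \<le> 2" .
    then have "a m n \<le> 2 * (\<bar>M\<bar> ^ m / fact m)"
      unfolding a_def by (intro mult_right_mono) auto
    moreover have "0 \<le> a m n" by (simp add: a_def)
    ultimately show ?thesis by simp
  qed
  have exp_summable: "summable (\<lambda>m. 2 * (\<bar>M\<bar> ^ m / fact m))"
    using summable_exp_generic[of "\<bar>M\<bar>"] by (intro summable_mult) (simp add: field_simps)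
  have "\<forall>\<^sub>F (m, n) in at_top \<times>\<^sub>F sequentially. norm (a m n) \<le> 2 * (\<bar>M\<bar> ^ m / fact m)"
    by (rule always_eventually) (use bound in auto)
  from tannerys_theorem[OF lim this exp_summable]
  have "(\<lambda>n. \<Sum>m. a m n) \<longlonglongrightarrow> (\<Sum>m. 0 :: real)" by simp
  then have "\<forall>\<^sub>F n in sequentially. (\<Sum>m. a m n) < e"
    using \<open>0 < e\<close> by (intro order_tendstoD) simp_all
  then show ?thesis
  proof eventually_elim
    case (elim n)
    show ?case
    proof
      fix \<Omega> assume "\<Omega> \<in> K"
      then have \<Omega>: "\<bar>\<Omega>\<bar> \<le> \<bar>M\<bar>" using assms(2) by fastforce
      define z where "z = - (\<i> * complex_of_real \<Omega>)"
      have nz: "cmod z = \<bar>\<Omega>\<bar>" by (simp add: z_def norm_mult)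
      have "(\<lambda>m. pade_ratio n m * (z ^ m / fact m)) sums F (- 1) n \<Omega>"
        unfolding F_def hyp1F1_terminating pade_ratio_def z_def
        using sums_finite[of "{..n}" "\<lambda>m. pochhammer (- of_nat n) m / pochhammer (- of_nat (2 * n + 1)) m
          * ((- (\<i> * complex_of_real \<Omega>)) ^ m / fact m)"]
        by (simp add: pochhammer_of_nat_eq_0_iff)
      moreover have "(\<lambda>m. (1 / 2) ^ m * (z ^ m / fact m)) sums cis (- (\<Omega> / 2))"
      proof -
        have "(\<lambda>m. (z / 2) ^ m /\<^sub>R fact m) sums exp (z / 2)" by (rule exp_converges)
        moreover have "exp (z / 2) = cis (- (\<Omega> / 2))" by (simp add: z_def cis_conv_exp)
        moreover have "(z / 2) ^ m /\<^sub>R fact m = (1 / 2) ^ m * (z ^ m / fact m)" for m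
          by (simp add: scaleR_conv_of_real power_divide field_simps)
        ultimately show ?thesis by simp
      qed
      ultimately have sums: "(\<lambda>m. (pade_ratio n m - (1 / 2) ^ m) * (z ^ m / fact m))
          sums (F (- 1) n \<Omega> - cis (- (\<Omega> / 2)))"
        unfolding left_diff_distrib by (rule sums_diff)
      have le: "cmod ((pade_ratio n m - (1 / 2) ^ m) * (z ^ m / fact m)) \<le> a m n" for m
        unfolding a_def norm_mult norm_divide norm_power norm_fact nz
        using \<Omega> by (intro mult_left_mono divide_right_mono power_mono) auto
      have sa: "summable (\<lambda>m. a m n)"
        by (rule summable_comparison_test'[OF exp_summable]) (use bound in auto)
      have "cmod (F (- 1) n \<Omega> - cis (- (\<Omega> / 2))) \<le> (\<Sum>m. a m n)"
        using norm_suminf_le[OF le sa] sums_unique[OF sums] by simp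
      with elim show "cmod (F (- 1) n \<Omega> - cis (- (\<Omega> / 2))) < e" by simp
    qed
  qed
qed

section \<open>Keeping the phase away from the imaginary axis\<close>

text \<open>
  The phase of \<open>w = (F\<^sub>N\<^sup>-)\<^sup>2 e\<^bsup>i\<Omega>\<^esup>\<close> must stay away from the imaginary axis, where \<open>\<Theta>\<^sub>N\<close> is
  singular. For large \<open>N\<close> this holds since \<open>F\<^sub>N\<^sup>-\<close> tends to \<open>e\<^bsup>-i\<Omega>/2\<^esup>\<close>; for each of the remaining
  \<open>N\<close>, \<open>norm_G_F\<close> shows that a small error forces \<open>\<Omega>\<close> to be small.
\<close>

lemma phase_near_1_large:
  assumes "compact K"
  shows "\<forall>\<^sub>F n in sequentially. \<forall>\<Omega>\<in>K. cmod ((F (- 1) n \<Omega>)\<^sup>2 * cis \<Omega> - 1) \<le> 1 / 4"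
proof -
  obtain M where M: "\<And>\<Omega>. \<Omega> \<in> K \<Longrightarrow> \<bar>\<Omega>\<bar> \<le> M"
    using compact_imp_bounded[OF assms] unfolding bounded_iff by auto
  \<comment> \<open>A distance below 1/10 from a unit number changes the square by at most
    \<open>(1/10)(2 + 1/10) = 0.21\<close>.\<close>
  have "\<forall>\<^sub>F n in sequentially. \<forall>\<Omega>\<in>K. cmod (F (- 1) n \<Omega> - cis (- (\<Omega> / 2))) < 1 / 10"
    by (rule F_uniform_limit) (use M in auto)
  then show ?thesis
  proof eventually_elim
    case (elim n)
    show ?case
    proof
      fix \<Omega> assume "\<Omega> \<in> K"
      define u d where "u = cis (- (\<Omega> / 2))" and "d = F (- 1) n \<Omega> - cis (- (\<Omega> / 2))"
      have d: "cmod d < 1 / 10" using elim \<open>\<Omega> \<in> K\<close> by (simp add: d_def)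
      have u: "cmod u = 1" by (simp add: u_def)
      have "u\<^sup>2 * cis \<Omega> = 1" by (simp add: u_def power2_eq_square cis_mult)
      moreover have "F (- 1) n \<Omega> = u + d" by (simp add: u_def d_def)
      ultimately have "(F (- 1) n \<Omega>)\<^sup>2 * cis \<Omega> - 1 = (d * (2 * u + d)) * cis \<Omega>"
        by (simp add: power2_eq_square algebra_simps)
      then have "cmod ((F (- 1) n \<Omega>)\<^sup>2 * cis \<Omega> - 1) = cmod d * cmod (2 * u + d)"
        by (simp add: norm_mult)
      also have "\<dots> \<le> 1 / 10 * (2 + 1 / 10)"
      proof (rule mult_mono)
        show "cmod (2 * u + d) \<le> 2 + 1 / 10"
          using norm_triangle_ineq[of "2 * u" d] d u by (simp add: norm_mult)
      qed (use d in auto)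
      finally show "cmod ((F (- 1) n \<Omega>)\<^sup>2 * cis \<Omega> - 1) \<le> 1 / 4" by simp
    qed
  qed
qed

lemma phase_near_1_fixed:
  assumes "compact K"
  shows "\<exists>\<delta>>0. \<forall>\<Omega>\<in>K. cmod (Err n \<Omega>) \<le> \<delta> \<longrightarrow> cmod ((F (- 1) n \<Omega>)\<^sup>2 * cis \<Omega> - 1) \<le> 1 / 4"
proof -
  let ?w = "\<lambda>\<Omega>. (F (- 1) n \<Omega>)\<^sup>2 * cis \<Omega>"
  have F_cont: "continuous_on A (F (- 1) n)" for A
    unfolding F_eq_pade_den by (intro continuous_intros)
  have "continuous_on UNIV ?w"
    by (intro continuous_intros F_cont)
  then have "isCont ?w 0" by (simp add: continuous_on_eq_continuous_at)
  moreover have "?w 0 = 1" by (simp add: F_eq_pade_den poly_pade_den_0)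
  ultimately obtain \<epsilon> where "\<epsilon> > 0"
    and \<epsilon>: "\<And>\<Omega>. \<bar>\<Omega>\<bar> < \<epsilon> \<Longrightarrow> cmod (?w \<Omega> - 1) < 1 / 4"
    unfolding continuous_at_eps_delta by (metis dist_norm diff_zero real_norm_def zero_less_divide_1_iff zero_less_numeral)
  obtain M where M: "\<And>\<Omega>. \<Omega> \<in> K \<Longrightarrow> cmod (F (- 1) n \<Omega>) \<le> M"
    using compact_imp_bounded[OF compact_continuous_image[OF F_cont assms]]
    unfolding bounded_iff by auto
  define c where "c = (cmod (coeff (pade_num n) (n + 1)))\<^sup>2"
  have "c > 0" using coeff_pade_num_top[of n] by (simp add: c_def)
  \<comment> \<open>The bound 1/2 excludes zeros of \<open>F\<close> and gives
    \<open>(1 + \<delta>)^2 \<le> 1 + 3 \<delta>\<close>. The other yields \<open>c \<Omega>^(2n+2)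
    \<le> 3 M^2 \<delta> < 4 (M^2 + 1) \<delta> \<le> c \<epsilon>^(2n+2)\<close>, hence
    \<open>|\<Omega>| < \<epsilon>\<close>.\<close>
  define \<delta> where "\<delta> = min (1 / 2) (c * \<epsilon> ^ (2 * n + 2) / (4 * (M\<^sup>2 + 1)))"
  have M1: "0 < 4 * (M\<^sup>2 + 1)" by (simp add: add_nonneg_pos)
  have "\<delta> > 0" using \<open>c > 0\<close> \<open>\<epsilon> > 0\<close> M1 by (simp add: \<delta>_def)
  have "cmod (?w \<Omega> - 1) \<le> 1 / 4" if "\<Omega> \<in> K" and E: "cmod (Err n \<Omega>) \<le> \<delta>" for \<Omega>
  proof -
    let ?f = "F (- 1) n \<Omega>" and ?g = "G 1 n \<Omega>" and ?E = "Err n \<Omega>"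
    have \<delta>: "\<delta> \<le> 1 / 2" unfolding \<delta>_def by (rule min.cobounded1)
    \<comment> \<open>At a zero of \<open>F\<close> the quotient in \<open>Err\<close> has the
      default value 0, so the error would be 1.\<close>
    have "?f \<noteq> 0"
    proof
      assume "?f = 0"
      then have "?E = 1" by (simp add: Err_def)
      with E \<delta> show False by simp
    qed
    then have "?g = cis \<Omega> * ?f * (1 - ?E)"
      by (simp add: Err_def field_simps)
    then have "cmod ?g = cmod ?f * cmod (1 - ?E)" by (simp add: norm_mult)
    moreover have "cmod (1 - ?E) \<le> 1 + \<delta>"
      using norm_triangle_ineq4[of 1 ?E] E by simp
    ultimately have "(cmod ?g)\<^sup>2 \<le> (cmod ?f)\<^sup>2 * (1 + \<delta>)\<^sup>2"
      by (simp add: power_mult_distrib mult_left_mono power_mono)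
    also have "\<dots> \<le> (cmod ?f)\<^sup>2 * (1 + 3 * \<delta>)"
    proof (rule mult_left_mono)
      have "\<delta> * \<delta> \<le> 1 * \<delta>" using \<delta> \<open>\<delta> > 0\<close> by (intro mult_right_mono) auto
      then show "(1 + \<delta>)\<^sup>2 \<le> 1 + 3 * \<delta>" by (simp add: power2_eq_square algebra_simps)
    qed simp
    finally have "c * \<Omega> ^ (2 * n + 2) \<le> (cmod ?f)\<^sup>2 * (3 * \<delta>)"
      using norm_G_F[of n \<Omega>] by (simp add: c_def algebra_simps)
    also have "\<dots> \<le> M\<^sup>2 * (3 * \<delta>)"
      using M[OF \<open>\<Omega> \<in> K\<close>] \<open>\<delta> > 0\<close> by (intro mult_right_mono power_mono) auto
    also have "\<dots> < \<delta> * (4 * (M\<^sup>2 + 1))"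
      using \<open>\<delta> > 0\<close> by (simp add: algebra_simps add_pos_nonneg)
    also have "\<dots> \<le> c * \<epsilon> ^ (2 * n + 2)"
    proof -
      have "\<delta> \<le> c * \<epsilon> ^ (2 * n + 2) / (4 * (M\<^sup>2 + 1))"
        unfolding \<delta>_def by (rule min.cobounded2)
      then show ?thesis using M1 by (simp only: pos_le_divide_eq)
    qed
    finally have "\<Omega> ^ (2 * n + 2) < \<epsilon> ^ (2 * n + 2)"
      using \<open>c > 0\<close> by (simp only: mult_less_cancel_left_pos)
    then have "\<bar>\<Omega>\<bar> ^ (2 * n + 2) < \<epsilon> ^ (2 * n + 2)" by (simp only: power_even_abs even_add even_mult_iff even_numeral simp_thms)
    then have "\<bar>\<Omega>\<bar> < \<epsilon>" by (rule power_less_imp_less_base) (use \<open>\<epsilon> > 0\<close> in simp)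
    then show ?thesis using \<epsilon>[of \<Omega>] by simp
  qed
  with \<open>\<delta> > 0\<close> show ?thesis by blast
qed

text \<open>Only finitely many degrees precede the threshold from \<open>phase_near_1_large\<close>,
  so the minimum of their individual bounds is positive and independent of \<open>n\<close>.\<close>

lemma phase_near_1:
  assumes "compact K"
  obtains \<delta> where "\<delta> > 0"
    and "\<And>n \<Omega>. \<Omega> \<in> K \<Longrightarrow> cmod (Err n \<Omega>) \<le> \<delta> \<Longrightarrow> cmod ((F (- 1) n \<Omega>)\<^sup>2 * cis \<Omega> - 1) \<le> 1 / 4"
proof -
  obtain n0 where n0:
    "\<And>n \<Omega>. n \<ge> n0 \<Longrightarrow> \<Omega> \<in> K \<Longrightarrow> cmod ((F (- 1) n \<Omega>)\<^sup>2 * cis \<Omega> - 1) \<le> 1 / 4"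
    using phase_near_1_large[OF assms] unfolding eventually_sequentially by blast
  obtain d where d: "\<And>n. d n > 0" and
    d': "\<And>n \<Omega>. \<Omega> \<in> K \<Longrightarrow> cmod (Err n \<Omega>) \<le> d n \<Longrightarrow> cmod ((F (- 1) n \<Omega>)\<^sup>2 * cis \<Omega> - 1) \<le> 1 / 4"
    using phase_near_1_fixed[OF assms] by metis
  define \<delta> where "\<delta> = Min (d ` {..n0})"
  show ?thesis
  proof
    show "\<delta> > 0" using d by (simp add: \<delta>_def)
    fix n \<Omega> assume *: "\<Omega> \<in> K" "cmod (Err n \<Omega>) \<le> \<delta>"
    show "cmod ((F (- 1) n \<Omega>)\<^sup>2 * cis \<Omega> - 1) \<le> 1 / 4"
    proof (cases "n \<ge> n0")
      case False
      then have "\<delta> \<le> d n" by (simp add: \<delta>_def)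
      with * d' show ?thesis by force
    qed (use n0 * in auto)
  qed
qed

section \<open>Second-order expansion of \<open>Xi\<close>\<close>

lemma Theta_eq:
  "Theta n \<Omega> = Im ((F (- 1) n \<Omega>)\<^sup>2 * cis \<Omega> * Err n \<Omega>) / Re ((F (- 1) n \<Omega>)\<^sup>2 * cis \<Omega>)"
  if "Re ((F (- 1) n \<Omega>)\<^sup>2 * cis \<Omega>) \<noteq> 0"
proof -
  define w where "w = (F (- 1) n \<Omega>)\<^sup>2 * cis \<Omega>"
  have "Re w \<noteq> 0" using that unfolding w_def .
  then have "Im (Err n \<Omega>) + Re (Err n \<Omega>) * (Im w / Re w) = Im (w * Err n \<Omega>) / Re w"
    by (simp add: field_simps)
  then show ?thesis by (simp only: Theta_def w_def)
qed

text \<open>By conjugation symmetry \<open>Xi\<close> is \<open>2 Re (f^2 + g^2)\<close> over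
  \<open>2 Re (f g)\<close>; solving the definition of the error for \<open>g\<close> removes
  it.\<close>

lemma Xi_eq:
  assumes "F (- 1) n \<Omega> \<noteq> 0"
  defines "w \<equiv> (F (- 1) n \<Omega>)\<^sup>2 * cis \<Omega>" and "E \<equiv> Err n \<Omega>"
  shows "Xi n \<Omega> = of_real (Re (cnj (cis \<Omega>) * w + cis \<Omega> * w * (1 - E)\<^sup>2) / Re (w * (1 - E)))"
proof -
  define f g where "f = F (- 1) n \<Omega>" and "g = G 1 n \<Omega>"
  have cnj: "F 1 n \<Omega> = cnj f" "G (- 1) n \<Omega> = cnj g"
    by (simp_all add: f_def g_def cnj_F cnj_G)
  have g: "g = cis \<Omega> * f * (1 - E)"
    using assms(1) by (simp add: E_def Err_def f_def g_def field_simps)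
  have one: "cnj (cis \<Omega>) * cis \<Omega> = 1"
    by (simp add: cis_cnj cis_mult)
  have f2: "f\<^sup>2 = cnj (cis \<Omega>) * w"
    unfolding w_def f_def[symmetric] using one by (simp add: mult.left_commute)
  have g2: "g\<^sup>2 = cis \<Omega> * w * (1 - E)\<^sup>2" and fg: "f * g = w * (1 - E)"
    by (simp_all add: g w_def f_def[symmetric] power2_eq_square)
  have cancel: "of_real (2 * a) / of_real (2 * b) = complex_of_real (a / b)" for a b :: real
    by simp
  have "Xi n \<Omega> = ((f\<^sup>2 + g\<^sup>2) + cnj (f\<^sup>2 + g\<^sup>2)) / (f * g + cnj (f * g))"
    unfolding Xi_def cnj by (simp add: f_def g_def add_ac)
  also have "\<dots> = of_real (2 * Re (f\<^sup>2 + g\<^sup>2)) / of_real (2 * Re (f * g))"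
    by (simp only: complex_add_cnj)
  also have "\<dots> = of_real (Re (f\<^sup>2 + g\<^sup>2) / Re (f * g))"
    using cancel .
  finally show ?thesis
    unfolding f2 g2 fg .
qed

text \<open>The first-order terms cancel because \<open>Re (e w E) = cos \<Omega> Re (w E) - sin \<Omega> Im (w E)\<close>.\<close>

lemma Xi_numerator_expansion:
  fixes w E :: complex
  assumes "T * Re w = Im (w * E)"
  shows "Re (cnj (cis \<Omega>) * w + cis \<Omega> * w * (1 - E)\<^sup>2)
    = (2 * cos \<Omega> + 2 * T * sin \<Omega>) * Re (w * (1 - E))
      + (Re (cis \<Omega> * w * E\<^sup>2) + 2 * T * sin \<Omega> * Re (w * E))"
proof -
  define v where "v = w * E"
  have "cnj (cis \<Omega>) * w + cis \<Omega> * w * (1 - E)\<^sup>2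
      = (cnj (cis \<Omega>) + cis \<Omega>) * w - 2 * (cis \<Omega> * v) + cis \<Omega> * w * E\<^sup>2"
    by (simp add: v_def power2_eq_square algebra_simps)
  also have "cnj (cis \<Omega>) + cis \<Omega> = of_real (2 * cos \<Omega>)"
    by (simp add: complex_eq_iff)
  finally have "Re (cnj (cis \<Omega>) * w + cis \<Omega> * w * (1 - E)\<^sup>2)
      = 2 * cos \<Omega> * Re w - 2 * (cos \<Omega> * Re v - sin \<Omega> * Im v) + Re (cis \<Omega> * w * E\<^sup>2)"
    by simp
  moreover have "Re (w * (1 - E)) = Re w - Re v"
    unfolding v_def by (simp add: algebra_simps)
  moreover have "Im v = T * Re w" using assms by (simp add: v_def)
  ultimately show ?thesis
    unfolding v_def[symmetric] by (simp only:) (simp add: algebra_simps)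
qed

text \<open>The phase bound gives \<open>|w| \<le> 5/4 \<le> 2 Re w\<close>, whence
  \<open>|T| \<le> 2 |E|\<close> and a denominator of at least \<open>|w| / 4\<close>. The remainder
  in the numerator is at most \<open>(1 + 4) |w| |E|^2\<close>, and the quotient produces
  20.\<close>

lemma Theta_Xi_bounds:
  assumes w1: "cmod ((F (- 1) n \<Omega>)\<^sup>2 * cis \<Omega> - 1) \<le> 1 / 4" and E1: "cmod (Err n \<Omega>) \<le> 1 / 4"
  shows "\<bar>Theta n \<Omega>\<bar> \<le> 2 * cmod (Err n \<Omega>)"
    and "cmod (Xi n \<Omega> - of_real (2 * cos \<Omega> + 2 * Theta n \<Omega> * sin \<Omega>)) \<le> 20 * (cmod (Err n \<Omega>))\<^sup>2"
proof -
  define w E T where "w = (F (- 1) n \<Omega>)\<^sup>2 * cis \<Omega>" and "E = Err n \<Omega>" and "T = Theta n \<Omega>"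
  have w: "cmod (w - 1) \<le> 1 / 4" and E: "cmod E \<le> 1 / 4"
    using assms by (simp_all add: w_def E_def)
  have Re_w: "Re w \<ge> 3 / 4" using abs_Re_le_cmod[of "w - 1"] w by simp
  moreover have "cmod w \<le> 5 / 4" using norm_triangle_ineq[of "w - 1" 1] w by simp
  ultimately have w_le: "cmod w \<le> 2 * Re w" by simp
  have w_pos: "cmod w > 0" using Re_w by auto
  have T: "T = Im (w * E) / Re w"
    using Theta_eq[of n \<Omega>] Re_w by (simp add: w_def E_def T_def)
  then have TRe: "T * Re w = Im (w * E)" using Re_w by simp
  have "\<bar>T\<bar> * Re w \<le> cmod w * cmod E"
    using abs_Im_le_cmod[of "w * E"] TRe Re_w by (simp add: norm_mult abs_mult flip: TRe)
  also have "\<dots> \<le> (2 * cmod E) * Re w"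
    using mult_right_mono[OF w_le, of "cmod E"] by (simp add: mult_ac)
  finally have T_le: "\<bar>T\<bar> \<le> 2 * cmod E"
    using Re_w by (simp add: mult_le_cancel_right)
  then show "\<bar>Theta n \<Omega>\<bar> \<le> 2 * cmod (Err n \<Omega>)" by (simp add: T_def E_def)
  define D N where "D = Re (w * (1 - E))"
    and "N = Re (cis \<Omega> * w * E\<^sup>2) + 2 * T * sin \<Omega> * Re (w * E)"
  have D: "D \<ge> cmod w / 4"
  proof -
    have "Re (w * E) \<le> cmod w * cmod E"
      using abs_Re_le_cmod[of "w * E"] by (simp add: norm_mult)
    also have "\<dots> \<le> cmod w * (1 / 4)" using E by (intro mult_left_mono) auto
    finally show ?thesis using w_le by (simp add: D_def algebra_simps)
  qed
  then have D_pos: "D > 0" using w_pos by linarith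
  have N: "\<bar>N\<bar> \<le> 5 * cmod w * (cmod E)\<^sup>2"
  proof -
    have "\<bar>Re (cis \<Omega> * w * E\<^sup>2)\<bar> \<le> cmod w * (cmod E)\<^sup>2"
      using abs_Re_le_cmod[of "cis \<Omega> * w * E\<^sup>2"] by (simp add: norm_mult norm_power)
    moreover have "\<bar>2 * T * sin \<Omega> * Re (w * E)\<bar> \<le> (2 * (2 * cmod E) * 1) * (cmod w * cmod E)"
      unfolding abs_mult
      using T_le abs_Re_le_cmod[of "w * E"] by (intro mult_mono) (auto simp: norm_mult)
    ultimately show ?thesis
      unfolding N_def by (simp add: power2_eq_square algebra_simps)
  qed
  have f0: "F (- 1) n \<Omega> \<noteq> 0" using w_pos by (auto simp: w_def)
  have "Xi n \<Omega> = of_real (((2 * cos \<Omega> + 2 * T * sin \<Omega>) * D + N) / D)"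
    unfolding Xi_eq[OF f0] w_def[symmetric] E_def[symmetric] Xi_numerator_expansion[OF TRe]
    by (simp only: D_def N_def)
  also have "((2 * cos \<Omega> + 2 * T * sin \<Omega>) * D + N) / D = (2 * cos \<Omega> + 2 * T * sin \<Omega>) + N / D"
    using D_pos by (simp add: add_divide_distrib)
  finally have "Xi n \<Omega> - of_real (2 * cos \<Omega> + 2 * T * sin \<Omega>) = of_real (N / D)"
    by (simp only: of_real_add) simp
  then have "cmod (Xi n \<Omega> - of_real (2 * cos \<Omega> + 2 * T * sin \<Omega>)) = \<bar>N\<bar> / D"
    using D_pos by (simp only: norm_of_real) simp
  also have "\<dots> \<le> 20 * (cmod E)\<^sup>2"
  proof -
    have "20 * (cmod E)\<^sup>2 * (cmod w / 4) \<le> 20 * (cmod E)\<^sup>2 * D"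
      using D by (intro mult_left_mono) auto
    then have "\<bar>N\<bar> \<le> 20 * (cmod E)\<^sup>2 * D" using N by (simp add: mult_ac)
    then show ?thesis using D_pos by (simp only: pos_divide_le_eq)
  qed
  finally show "cmod (Xi n \<Omega> - of_real (2 * cos \<Omega> + 2 * Theta n \<Omega> * sin \<Omega>))
      \<le> 20 * (cmod (Err n \<Omega>))\<^sup>2"
    by (simp only: T_def E_def)
qed

section \<open>The square root and the relative error\<close>

text \<open>
  Compares \<open>\<plusminus>sqrt (1 - x\<^sup>2)\<close> with its linearisation \<open>s - c T\<close> through the difference of their
  squares; since both have the sign of \<open>s\<close>, their sum is at least \<open>|s| / 2\<close> in absolute value.
\<close>

lemma sqrt_perturbation:
  fixes c s T r \<eta> :: real
  assumes cs: "c\<^sup>2 + s\<^sup>2 = 1" and T: "\<bar>T\<bar> \<le> 2 * \<eta>" and r: "\<bar>r\<bar> \<le> 10 * \<eta>\<^sup>2"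
    and \<eta>: "\<eta> \<le> \<bar>s\<bar> / 40"
  defines "x \<equiv> c + T * s + r" and "\<tau> \<equiv> if s \<ge> 0 then 1 else - 1"
  shows "x\<^sup>2 \<le> 1" and "\<bar>\<tau> * sqrt (1 - x\<^sup>2) - (s - c * T)\<bar> \<le> 90 * \<eta>\<^sup>2 / \<bar>s\<bar>"
proof -
  define y0 q where "y0 = s - c * T" and "q = T\<^sup>2 + 2 * r * (c + T * s) + r\<^sup>2"
  have c1: "\<bar>c\<bar> \<le> 1" and s1: "\<bar>s\<bar> \<le> 1"
    unfolding abs_square_le_1[symmetric]
    using cs zero_le_power2[of c] zero_le_power2[of s] by linarith+
  have \<eta>0: "\<eta> \<ge> 0" using T by linarith
  have \<eta>1: "\<eta> \<le> 1 / 40" using \<eta> s1 by linarith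
  \<comment> \<open>Uses \<open>(s - c T)^2 + (c + T s)^2 = (c^2 + s^2)(1 + T^2)\<close>.\<close>
  have "y0\<^sup>2 - (1 - x\<^sup>2) = (c\<^sup>2 + s\<^sup>2) * (1 + T\<^sup>2) - 1 + 2 * r * (c + T * s) + r\<^sup>2"
    unfolding y0_def x_def by (simp add: power2_eq_square algebra_simps)
  then have y0_sq: "y0\<^sup>2 - (1 - x\<^sup>2) = q" by (simp add: cs q_def)
  \<comment> \<open>The three terms of \<open>q\<close> contribute 4, 40 and 1.\<close>
  have q: "\<bar>q\<bar> \<le> 45 * \<eta>\<^sup>2"
  proof -
    have "\<bar>T\<^sup>2\<bar> \<le> (2 * \<eta>)\<^sup>2"
      using power_mono[OF T abs_ge_zero, of 2] by simp
    then have "\<bar>T\<^sup>2\<bar> \<le> 4 * \<eta>\<^sup>2" by (simp add: power_mult_distrib)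
    moreover have "\<bar>2 * r * (c + T * s)\<bar> \<le> (2 * (10 * \<eta>\<^sup>2)) * 2"
    proof -
      have "\<bar>T * s\<bar> \<le> 1 * 1"
        unfolding abs_mult using T \<eta>1 s1 by (intro mult_mono) auto
      then have "\<bar>c + T * s\<bar> \<le> 2" using c1 by linarith
      then show ?thesis unfolding abs_mult using r by (intro mult_mono) auto
    qed
    moreover have "\<bar>r\<^sup>2\<bar> \<le> 1 * \<eta>\<^sup>2"
    proof -
      have "10 * \<eta>\<^sup>2 \<le> 1 * \<eta>"
        using mult_right_mono[of "10 * \<eta>" 1 \<eta>] \<eta>1 \<eta>0 by (simp add: power2_eq_square)
      then have "\<bar>r\<bar> \<le> \<bar>\<eta>\<bar>" using r \<eta>0 by linarith
      then have "r\<^sup>2 \<le> \<eta>\<^sup>2" by (simp only: abs_le_square_iff)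
      then show ?thesis by simp
    qed
    ultimately show ?thesis unfolding q_def by linarith
  qed
  have "\<bar>c * T\<bar> \<le> 1 * (2 * \<eta>)" unfolding abs_mult using c1 T by (intro mult_mono) auto
  then have cT: "\<bar>c * T\<bar> \<le> \<bar>s\<bar> / 20" using \<eta> by linarith
  then have \<tau>y0: "\<tau> * y0 \<ge> \<bar>s\<bar> / 2"
    unfolding \<tau>_def y0_def by (cases "s \<ge> 0") (auto simp: abs_le_iff)
  have \<tau>2: "\<tau> * \<tau> = 1" by (simp add: \<tau>_def)
  \<comment> \<open>The radicand is \<open>y0^2 - q\<close>, at least
    \<open>s^2 / 4 - 45 s^2 / 1600\<close>.\<close>
  have "\<eta>\<^sup>2 \<le> (\<bar>s\<bar> / 40)\<^sup>2" using \<eta> \<eta>0 by (intro power_mono)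
  then have "\<eta>\<^sup>2 \<le> s\<^sup>2 / 1600" by (simp add: power_divide)
  moreover have "y0\<^sup>2 \<ge> s\<^sup>2 / 4"
  proof -
    have "(\<bar>s\<bar> / 2)\<^sup>2 \<le> (\<tau> * y0)\<^sup>2" using \<tau>y0 by (intro power_mono) auto
    then show ?thesis using \<tau>2 by (simp add: power_divide power_mult_distrib power2_eq_square[of \<tau>])
  qed
  ultimately have x: "1 - x\<^sup>2 \<ge> s\<^sup>2 / 8" using q y0_sq zero_le_power2[of s] by linarith
  then show x1: "x\<^sup>2 \<le> 1" using zero_le_power2[of s] by linarith
  define y where "y = \<tau> * sqrt (1 - x\<^sup>2)"
  have y2: "y\<^sup>2 = 1 - x\<^sup>2"
    using x1 \<tau>2 by (simp add: y_def power_mult_distrib power2_eq_square[of \<tau>])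
  show "\<bar>\<tau> * sqrt (1 - x\<^sup>2) - (s - c * T)\<bar> \<le> 90 * \<eta>\<^sup>2 / \<bar>s\<bar>"
  \<comment> \<open>For \<open>s = 0\<close> the right-hand side is 0 by the convention for
    division, and the assumption on \<open>\<eta>\<close> makes both compared values vanish.\<close>
  proof (cases "s = 0")
    case True
    then have "\<eta> = 0" using \<eta> \<eta>0 by simp
    then have "T = 0" and "q = 0" using T q by simp_all
    then have "y0 = 0" and "y\<^sup>2 = 0" using True y0_sq y2 by (simp_all add: y0_def)
    then show ?thesis unfolding y_def[symmetric] y0_def[symmetric] by simp
  next
    case False
    have "\<tau> * y \<ge> 0" using \<tau>2 x1 by (simp add: y_def mult.assoc[symmetric])
    then have "\<bar>s\<bar> / 2 \<le> \<tau> * (y + y0)" using \<tau>y0 by (simp add: distrib_left)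
    also have "\<dots> \<le> \<bar>y + y0\<bar>"
      using abs_ge_self[of "y + y0"] abs_ge_minus_self[of "y + y0"] by (simp add: \<tau>_def)
    finally have "\<bar>y - y0\<bar> * (\<bar>s\<bar> / 2) \<le> \<bar>y - y0\<bar> * \<bar>y + y0\<bar>"
      by (intro mult_left_mono) auto
    also have "\<dots> = \<bar>y\<^sup>2 - y0\<^sup>2\<bar>" by (simp add: abs_mult[symmetric] power2_eq_square algebra_simps)
    also have "\<dots> \<le> 45 * \<eta>\<^sup>2" using q y0_sq y2 by linarith
    finally have "\<bar>y - y0\<bar> \<le> 90 * \<eta>\<^sup>2 / \<bar>s\<bar>" using False by (simp add: field_simps)
    then show ?thesis by (simp only: y_def y0_def)
  qed
qed

text \<open>Multiplying by \<open>cis (\<sigma> * \<Omega>)\<close>, of modulus 1, turns the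
  difference into \<open>-(r + \<sigma> \<i> (y - (s - c T)))\<close>. Its two parts contribute 10
  and 90 to the constant, using \<open>|s| \<le> 1\<close>.\<close>

lemma rho_bound:
  assumes w1: "cmod ((F (- 1) n \<Omega>)\<^sup>2 * cis \<Omega> - 1) \<le> 1 / 4"
    and E1: "cmod (Err n \<Omega>) \<le> \<bar>sin \<Omega>\<bar> / 40" and \<sigma>: "\<sigma> \<in> {1, -1}"
  shows "cmod (rho \<sigma> n \<Omega> - of_real \<sigma> * \<i> * of_real (Theta n \<Omega>))
           \<le> 100 * (cmod (Err n \<Omega>))\<^sup>2 / \<bar>sin \<Omega>\<bar>"
proof -
  define c s T \<eta> where "c = cos \<Omega>" and "s = sin \<Omega>" and "T = Theta n \<Omega>" and "\<eta> = cmod (Err n \<Omega>)"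
  define r where "r = Re (Xi n \<Omega>) / 2 - (c + T * s)"
  define x where "x = c + T * s + r"
  define \<tau> :: real where "\<tau> = (if s \<ge> 0 then 1 else - 1)"
  define y where "y = \<tau> * sqrt (1 - x\<^sup>2)"
  have \<eta>: "\<eta> \<le> \<bar>s\<bar> / 40" using E1 by (simp add: \<eta>_def s_def)
  have s1: "\<bar>s\<bar> \<le> 1" by (simp add: s_def)
  have "cmod (Err n \<Omega>) \<le> 1 / 4" using \<eta> s1 unfolding \<eta>_def by linarith
  note bounds = Theta_Xi_bounds[OF w1 this]
  have T: "\<bar>T\<bar> \<le> 2 * \<eta>" using bounds(1) by (simp add: T_def \<eta>_def)
  have Xi: "Xi n \<Omega> = of_real (2 * x)"
    using Xi_real[of n \<Omega>] by (simp add: x_def r_def of_real_Re)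
  then have "Xi n \<Omega> - of_real (2 * c + 2 * T * s) = of_real (2 * r)"
    by (simp add: x_def)
  then have "\<bar>2 * r\<bar> \<le> 20 * \<eta>\<^sup>2"
    using bounds(2) by (simp only: c_def s_def T_def \<eta>_def norm_of_real)
  then have r: "\<bar>r\<bar> \<le> 10 * \<eta>\<^sup>2" by (simp add: abs_mult)
  have cs: "c\<^sup>2 + s\<^sup>2 = 1" by (simp add: c_def s_def)
  note perturb = sqrt_perturbation[OF cs T r \<eta>, folded x_def \<tau>_def, folded y_def]
  have "(Xi n \<Omega>)\<^sup>2 - 4 = of_real (- (2\<^sup>2 * (1 - x\<^sup>2)))"
    by (simp add: Xi power_mult_distrib algebra_simps)
  also have "csqrt \<dots> = \<i> * of_real (sqrt (2\<^sup>2 * (1 - x\<^sup>2)))"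
    using perturb(1) by (subst csqrt_of_real_nonpos) simp_all
  also have "sqrt (2\<^sup>2 * (1 - x\<^sup>2)) = 2 * sqrt (1 - x\<^sup>2)"
    by (simp only: real_sqrt_mult real_sqrt_abs abs_numeral)
  finally have csqrt: "csqrt ((Xi n \<Omega>)\<^sup>2 - 4) = \<i> * of_real (2 * sqrt (1 - x\<^sup>2))" .
  \<comment> \<open>The labelling of the roots by the sign of \<open>sin \<Omega>\<close> is exactly
    the factor \<open>\<tau>\<close> in \<open>y\<close>.\<close>
  have lam: "lam \<sigma> n \<Omega> = of_real x + of_real \<sigma> * \<i> * of_real y"
    unfolding lam_def csqrt unfolding Xi y_def \<tau>_def s_def by (simp add: field_simps)
  have cis: "cis (\<sigma> * \<Omega>) = of_real c + of_real \<sigma> * \<i> * of_real s"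
    using \<sigma> by (auto simp: c_def s_def complex_eq_iff)
  have \<sigma>2: "complex_of_real \<sigma> * of_real \<sigma> = 1" using \<sigma> by auto
  have "rho \<sigma> n \<Omega> - of_real \<sigma> * \<i> * of_real T
      = (cis (\<sigma> * \<Omega>) * (1 - of_real \<sigma> * \<i> * of_real T) - lam \<sigma> n \<Omega>) / cis (\<sigma> * \<Omega>)"
    unfolding rho_def by (simp add: field_simps)
  also have "cis (\<sigma> * \<Omega>) * (1 - of_real \<sigma> * \<i> * of_real T) - lam \<sigma> n \<Omega>
      = - of_real r - of_real \<sigma> * \<i> * of_real (y - (s - c * T))
        + (of_real \<sigma> * of_real \<sigma> - 1) * of_real (T * s)"
    unfolding cis lam x_def by (simp add: algebra_simps)
  also have "\<dots> = - (of_real r + of_real \<sigma> * \<i> * of_real (y - (s - c * T)))"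
    unfolding \<sigma>2 by simp
  finally have "cmod (rho \<sigma> n \<Omega> - of_real \<sigma> * \<i> * of_real T)
      = cmod (of_real r + of_real \<sigma> * \<i> * of_real (y - (s - c * T)))"
    by (simp only: norm_divide norm_minus_cancel norm_cis div_by_1)
  also have "\<dots> \<le> \<bar>r\<bar> + \<bar>y - (s - c * T)\<bar>"
    using \<sigma> by (intro order_trans[OF norm_triangle_ineq]) (auto simp: norm_mult simp flip: of_real_diff of_real_mult)
  also have "\<dots> \<le> 10 * (\<eta>\<^sup>2 / \<bar>s\<bar>) + 90 * \<eta>\<^sup>2 / \<bar>s\<bar>"
  proof (rule add_mono[OF order_trans[OF r] perturb(2)])
    show "10 * \<eta>\<^sup>2 \<le> 10 * (\<eta>\<^sup>2 / \<bar>s\<bar>)"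
    proof (cases "s = 0")
      case True
      then have "\<eta> = 0" using \<eta> by (simp add: \<eta>_def)
      then show ?thesis by simp
    next
      case False
      then show ?thesis using mult_left_mono[OF s1, of "\<eta>\<^sup>2"] by (simp add: pos_le_divide_eq)
    qed
  qed
  also have "\<dots> = 100 * \<eta>\<^sup>2 / \<bar>s\<bar>" by simp
  finally show ?thesis by (simp only: T_def \<eta>_def s_def)
qed

section \<open>Uniform expansions on compact sets\<close>

lemma rho_expansion:
  assumes "compact K" and \<sigma>: "\<sigma> \<in> {1, -1}"
  shows "\<exists>\<delta>>0. \<forall>n. \<forall>\<Omega>\<in>K. cmod (Err n \<Omega>) \<le> \<delta> * \<bar>sin \<Omega>\<bar> \<longrightarrow>
    cmod (rho \<sigma> n \<Omega> - of_real \<sigma> * \<i> * of_real (Theta n \<Omega>))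
      \<le> 100 * (cmod (Err n \<Omega>))\<^sup>2 / \<bar>sin \<Omega>\<bar>"
proof -
  obtain \<delta> where "\<delta> > 0" and \<delta>:
    "\<And>n \<Omega>. \<Omega> \<in> K \<Longrightarrow> cmod (Err n \<Omega>) \<le> \<delta> \<Longrightarrow> cmod ((F (- 1) n \<Omega>)\<^sup>2 * cis \<Omega> - 1) \<le> 1 / 4"
    using phase_near_1[OF assms(1)] by blast
  \<comment> \<open>As \<open>|sin \<Omega>| \<le> 1\<close>, the first entry of the minimum secures
    the phase bound; 1/40 is the smallness required by \<open>rho_bound\<close>.\<close>
  have "cmod (rho \<sigma> n \<Omega> - of_real \<sigma> * \<i> * of_real (Theta n \<Omega>))
      \<le> 100 * (cmod (Err n \<Omega>))\<^sup>2 / \<bar>sin \<Omega>\<bar>"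
    if "\<Omega> \<in> K" and E: "cmod (Err n \<Omega>) \<le> min \<delta> (1 / 40) * \<bar>sin \<Omega>\<bar>" for n \<Omega>
  proof (rule rho_bound[OF \<delta>[OF \<open>\<Omega> \<in> K\<close>] _ \<sigma>])
    have "min \<delta> (1 / 40) * \<bar>sin \<Omega>\<bar> \<le> \<delta> * 1"
      using \<open>\<delta> > 0\<close> by (intro mult_mono) auto
    then show "cmod (Err n \<Omega>) \<le> \<delta>" using E by simp
    have "min \<delta> (1 / 40) * \<bar>sin \<Omega>\<bar> \<le> 1 / 40 * \<bar>sin \<Omega>\<bar>"
      by (intro mult_right_mono) auto
    then show "cmod (Err n \<Omega>) \<le> \<bar>sin \<Omega>\<bar> / 40" using E by simp
  qed
  moreover have "min \<delta> (1 / 40) > 0" using \<open>\<delta> > 0\<close> by simp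
  ultimately show ?thesis by blast
qed

lemma Xi_expansion:
  assumes "compact K"
  shows "O_Err_squared_on K
    (\<lambda>n \<Omega>. Xi n \<Omega> - of_real (2 * cos \<Omega> + 2 * Theta n \<Omega> * sin \<Omega>))"
proof -
  obtain \<delta> where "\<delta> > 0" and \<delta>:
    "\<And>n \<Omega>. \<Omega> \<in> K \<Longrightarrow> cmod (Err n \<Omega>) \<le> \<delta> \<Longrightarrow> cmod ((F (- 1) n \<Omega>)\<^sup>2 * cis \<Omega> - 1) \<le> 1 / 4"
    using phase_near_1[OF assms] by blast
  show ?thesis
    unfolding O_Err_squared_on_def
  proof (intro exI conjI allI ballI impI)
    show "min \<delta> (1 / 4) > 0" using \<open>\<delta> > 0\<close> by simp
    fix n \<Omega> assume "\<Omega> \<in> K" and "cmod (Err n \<Omega>) \<le> min \<delta> (1 / 4)"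
    then show "cmod (Xi n \<Omega> - of_real (2 * cos \<Omega> + 2 * Theta n \<Omega> * sin \<Omega>))
        \<le> 20 * (cmod (Err n \<Omega>))\<^sup>2"
      using \<delta> by (intro Theta_Xi_bounds) auto
  qed
qed

text \<open>By compactness \<open>|sin \<Omega>|\<close> has a positive minimum \<open>m\<close> on
  \<open>K\<close>, which is absorbed into both constants. An empty \<open>K\<close> is split off
  because no minimum is attained there.\<close>

lemma rho_expansion_away_from_zeros:
  assumes "compact K" and sin: "\<forall>\<Omega>\<in>K. sin \<Omega> \<noteq> 0" and \<sigma>: "\<sigma> \<in> {1, -1}"
  shows "O_Err_squared_on K (\<lambda>n \<Omega>. rho \<sigma> n \<Omega> - of_real \<sigma> * \<i> * of_real (Theta n \<Omega>))"
proof (cases "K = {}")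
  case True
  then show ?thesis by (auto simp: O_Err_squared_on_def intro: exI[of _ 1])
next
  case False
  have "continuous_on K (\<lambda>\<Omega>. \<bar>sin \<Omega>\<bar>)" by (intro continuous_intros)
  then obtain \<Omega>0 where "\<Omega>0 \<in> K" and min: "\<And>\<Omega>. \<Omega> \<in> K \<Longrightarrow> \<bar>sin \<Omega>0\<bar> \<le> \<bar>sin \<Omega>\<bar>"
    using continuous_attains_inf[OF assms(1) False] by blast
  define m where "m = \<bar>sin \<Omega>0\<bar>"
  have "m > 0" using \<open>\<Omega>0 \<in> K\<close> sin by (simp add: m_def)
  obtain \<delta> where "\<delta> > 0" and \<delta>: "\<And>n \<Omega>. \<Omega> \<in> K \<Longrightarrow> cmod (Err n \<Omega>) \<le> \<delta> * \<bar>sin \<Omega>\<bar> \<Longrightarrow>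
    cmod (rho \<sigma> n \<Omega> - of_real \<sigma> * \<i> * of_real (Theta n \<Omega>))
      \<le> 100 * (cmod (Err n \<Omega>))\<^sup>2 / \<bar>sin \<Omega>\<bar>"
    using rho_expansion[OF assms(1) \<sigma>] by blast
  show ?thesis
    unfolding O_Err_squared_on_def
  proof (intro exI conjI allI ballI impI)
    show "\<delta> * m > 0" using \<open>\<delta> > 0\<close> \<open>m > 0\<close> by simp
    fix n \<Omega> assume "\<Omega> \<in> K" and E: "cmod (Err n \<Omega>) \<le> \<delta> * m"
    have m: "m \<le> \<bar>sin \<Omega>\<bar>" using min[OF \<open>\<Omega> \<in> K\<close>] by (simp add: m_def)
    then have "\<delta> * m \<le> \<delta> * \<bar>sin \<Omega>\<bar>" using \<open>\<delta> > 0\<close> by simp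
    then have "cmod (rho \<sigma> n \<Omega> - of_real \<sigma> * \<i> * of_real (Theta n \<Omega>))
        \<le> 100 * (cmod (Err n \<Omega>))\<^sup>2 / \<bar>sin \<Omega>\<bar>"
      using E by (intro \<delta>[OF \<open>\<Omega> \<in> K\<close>]) linarith
    also have "\<dots> \<le> 100 * (cmod (Err n \<Omega>))\<^sup>2 / m"
      using m \<open>m > 0\<close> by (intro divide_left_mono) auto
    finally show "cmod (rho \<sigma> n \<Omega> - of_real \<sigma> * \<i> * of_real (Theta n \<Omega>))
        \<le> 100 / m * (cmod (Err n \<Omega>))\<^sup>2" by simp
  qed
qed

theorem theorem4p3:
  shows "(\<forall>N. \<exists>P Q. pade_approximant (N + 1) N (fps_exp 1) P Q \<and>
            (\<forall>\<Omega>. G 1 N \<Omega> = poly P (\<i> * of_real \<Omega>) \<and> F (-1) N \<Omega> = poly Q (\<i> * of_real \<Omega>)))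
    \<and> (\<forall>K. compact K \<longrightarrow>
          O_Err_squared_on K
            (\<lambda>N \<Omega>. Xi N \<Omega> - of_real (2 * cos \<Omega> + 2 * Theta N \<Omega> * sin \<Omega>)))
    \<and> (\<forall>K. compact K \<and> (\<forall>\<Omega>\<in>K. sin \<Omega> \<noteq> 0) \<longrightarrow>
          (\<forall>\<sigma>\<in>{1, -1}. O_Err_squared_on K
            (\<lambda>N \<Omega>. rho \<sigma> N \<Omega> - of_real \<sigma> * \<i> * of_real (Theta N \<Omega>))))
    \<and> (\<forall>K. compact K \<longrightarrow>
          (\<forall>\<sigma>\<in>{1, -1}. \<exists>C. \<exists>\<delta>>0. \<forall>N. \<forall>\<Omega>\<in>K. cmod (Err N \<Omega>) \<le> \<delta> * \<bar>sin \<Omega>\<bar> \<longrightarrow>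
            cmod (rho \<sigma> N \<Omega> - of_real \<sigma> * \<i> * of_real (Theta N \<Omega>))
              \<le> C * (cmod (Err N \<Omega>))\<^sup>2 / \<bar>sin \<Omega>\<bar>))"
proof (intro conjI allI impI ballI)
  fix N
  show "\<exists>P Q. pade_approximant (N + 1) N (fps_exp 1) P Q \<and>
      (\<forall>\<Omega>. G 1 N \<Omega> = poly P (\<i> * of_real \<Omega>) \<and> F (-1) N \<Omega> = poly Q (\<i> * of_real \<Omega>))"
    using pade_approximant_exp[of N]
    by (intro exI[of _ "pade_num N"] exI[of _ "pade_den N"])
       (simp add: F_eq_pade_den G_eq_pade_num)
next
  fix K :: "real set" and \<sigma> :: real
  assume "compact K" and "\<sigma> \<in> {1, -1}"
  then show "\<exists>C. \<exists>\<delta>>0. \<forall>N. \<forall>\<Omega>\<in>K. cmod (Err N \<Omega>) \<le> \<delta> * \<bar>sin \<Omega>\<bar> \<longrightarrow>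
      cmod (rho \<sigma> N \<Omega> - of_real \<sigma> * \<i> * of_real (Theta N \<Omega>))
        \<le> C * (cmod (Err N \<Omega>))\<^sup>2 / \<bar>sin \<Omega>\<bar>"
    by (intro exI[of _ 100] rho_expansion)
qed (use Xi_expansion rho_expansion_away_from_zeros in auto)

end
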